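(* Let $(\psi,\Psi):(a,X)\to(b,Y)$ be a map of hybrid dynamical systems. Then $(\psi,\Psi)$ sends executions of $(a,X)$ to executions of $(b,Y)$: for every execution $(\varphi,\sigma):(\mathscr{I}(\{t_i\}),\partial)\to(a,X)$ of $(a,X)$, the composite $(\psi,\Psi)\circ(\varphi,\sigma):(\mathscr{I}(\{t_i\}),\partial)\to(b,Y)$ is an execution of $(b,Y)$.
   Context: **Manifolds and relations.** $\mathsf{Man}$ is the category of (Hausdorff, paracompact) manifolds with corners, locally modelled on sectors $[0,\infty)^k\times\mathbb{R}^{n-k}$, and smooth maps (maps which in charts extend locally to smooth maps between open subsets of Euclidean spaces). A relation $R:M\to N$ is a subset $R\subset M\times N$; the composite of $R:M\to N$ and $S:N\to P$ is $S\circ R=\{(x,z)\mid\exists y:\ (x,y)\in R,\ (y,z)\in S\}$. $\mathsf{RelMan}$ is the category of manifolds with corners and arbitrary set-theoretic relations (identities are the diagonals). **Hybrid phase spaces.** A hybrid phase space is a functor $a:S_a\to\mathsf{RelMan}$ from a small category $S_a$ (by convention $S_a$ and all the manifolds $a(x)$ are nonempty). A map $a\to b$ of hybrid phase spaces is a pair $(\varphi,\Phi)$ consisting of a functor $\varphi:S_a\to S_b$ and a family of smooth maps $\Phi=\{\Phi_x:a(x)\to b(\varphi(x))\}_{x\in(S_a)_0}$ such that $(\Phi_x\times\Phi_y)(a(\gamma))\subset b(\varphi(\gamma))$ for every arrow $\gamma:x\to y$ of $S_a$. The composite is $(\psi,\Psi)\circ(\varphi,\Phi)=(\psi\circ\varphi,\{\Psi_{\varphi(x)}\circ\Phi_x\}_x)$.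 This gives the category $\mathsf{HyPh}$. The functor $\mathbb{U}:\mathsf{HyPh}\to\mathsf{Man}$ sends $a$ to $\bigsqcup_{x\in(S_a)_0}a(x)$ and $(\varphi,\Phi)$ to the map induced by the composites $a(x)\xrightarrow{\Phi_x}b(\varphi(x))\hookrightarrow\mathbb{U}(b)$. **Hybrid dynamical systems.** A hybrid dynamical system is a pair $(a,X)$ with $a$ a hybrid phase space and $X$ a vector field on the manifold with corners $\mathbb{U}(a)$. A map $(a,X)\to(b,Y)$ of hybrid dynamical systems is a map $(\varphi,\Phi):a\to b$ of hybrid phase spaces such that $Y$ is $\mathbb{U}(\varphi,\Phi)$-related to $X$, i.e. $T(\mathbb{U}(\varphi,\Phi))\circ X=Y\circ\mathbb{U}(\varphi,\Phi)$. Composition is composition in $\mathsf{HyPh}$. **Executions.** Let $\{t_i\}_{i=0}^\infty$ be an increasing sequence of real numbers. Let $\mathscr{T}$ be the directed graph with vertex set $\mathbb{N}=\{0,1,2,\dots\}$ and exactly one arrow $i\to i+1$ for each $i\in\mathbb{N}$. The hybrid phase space $\mathscr{I}(\{t_i\})$ is the functor $\mathrm{Free}(\mathscr{T})\to\mathsf{RelMan}$ on the free category generated by $\mathscr{T}$ that sends the vertex $i$ to $[t_i,t_{i+1}]$ and the generating arrow $i\to i+1$ to the one-point relation $\{(t_{i+1},t_{i+1})\}\subset[t_i,t_{i+1}]\times[t_{i+1},t_{i+2}]$. The vector field $\partial$ on $\mathbb{U}(\mathscr{I}(\{t_i\}))=\bigsqcup_{i\ge0}[t_i,t_{i+1}]$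 is $\frac{d}{dt}$ on each $[t_i,t_{i+1}]$. An execution of a hybrid dynamical system $(a,X)$ is an increasing sequence $\{t_i\}_{i=0}^\infty$ of real numbers together with a map of hybrid dynamical systems $(\varphi,\sigma):(\mathscr{I}(\{t_i\}),\partial)\to(a,X)$. *)

theory Defs
  imports "HOL-Analysis.Analysis"
begin

section \<open>Smooth functions on Euclidean spaces and sectors\<close>

text \<open>
  Since the components of a manifold may have different dimensions, $\mathbb{R}^n$ is
  \<^const>\<open>Euclidean_space\<close>: functions \<open>nat \<Rightarrow> real\<close> that vanish from index \<open>n\<close> on.
  \<open>Ck_on k n W f\<close> says that all iterated partial derivatives of \<open>f\<close> of order at most \<open>k\<close> exist
  and are continuous on the open set \<open>W\<close>.
\<close>

fun Ck_on :: "nat \<Rightarrow> nat \<Rightarrow> (nat \<Rightarrow> real) set \<Rightarrow> ((nat \<Rightarrow> real) \<Rightarrow> real) \<Rightarrow> bool" where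
  "Ck_on 0 n W f \<longleftrightarrow> continuous_map (subtopology (Euclidean_space n) W) euclideanreal f"
| "Ck_on (Suc k) n W f \<longleftrightarrow>
     continuous_map (subtopology (Euclidean_space n) W) euclideanreal f \<and>
     (\<forall>i<n. \<exists>g. Ck_on k n W g \<and>
        (\<forall>x\<in>W. ((\<lambda>s. f (x(i := s))) has_real_derivative g x) (at (x i))))"

definition smooth_open :: "nat \<Rightarrow> (nat \<Rightarrow> real) set \<Rightarrow> nat \<Rightarrow> ((nat \<Rightarrow> real) \<Rightarrow> nat \<Rightarrow> real) \<Rightarrow> bool" where
  "smooth_open m W n F \<longleftrightarrow>
     openin (Euclidean_space m) W \<and> F ` W \<subseteq> topspace (Euclidean_space n) \<and>
     (\<forall>j<n. \<forall>k. Ck_on k m W (\<lambda>x. F x j))"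

definition locally_extends_smoothly ::
    "nat \<Rightarrow> (nat \<Rightarrow> real) set \<Rightarrow> nat \<Rightarrow> ((nat \<Rightarrow> real) \<Rightarrow> nat \<Rightarrow> real) \<Rightarrow> bool" where
  "locally_extends_smoothly m A n g \<longleftrightarrow>
     (\<forall>x\<in>A. \<exists>W F. x \<in> W \<and> smooth_open m W n F \<and> (\<forall>y\<in>W \<inter> A. F y = g y))"

definition sector :: "nat \<Rightarrow> nat \<Rightarrow> (nat \<Rightarrow> real) topology" where
  "sector k n = subtopology (Euclidean_space n) {x. \<forall>i<k. 0 \<le> x i}"


section \<open>Manifolds with corners\<close>

definition paracompact_space :: "'p topology \<Rightarrow> bool" where
  "paracompact_space T \<longleftrightarrow>
     (\<forall>\<U>. (\<forall>U\<in>\<U>. openin T U) \<and> \<Union>\<U> = topspace T \<longrightarrow>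
        (\<exists>\<V>. (\<forall>V\<in>\<V>. openin T V) \<and> \<Union>\<V> = topspace T \<and>
             (\<forall>V\<in>\<V>. \<exists>U\<in>\<U>. V \<subseteq> U) \<and> locally_finite_in T \<V>))"

record 'p chart =
  chart_dim :: nat
  chart_corner :: nat
  chart_dom :: "'p set"
  chart_map :: "'p \<Rightarrow> nat \<Rightarrow> real"

abbreviation chart_img :: "'p chart \<Rightarrow> (nat \<Rightarrow> real) set" where
  "chart_img c \<equiv> chart_map c ` chart_dom c"

abbreviation chart_inv :: "'p chart \<Rightarrow> (nat \<Rightarrow> real) \<Rightarrow> 'p" where
  "chart_inv c \<equiv> inv_into (chart_dom c) (chart_map c)"

definition is_chart :: "'p topology \<Rightarrow> 'p chart \<Rightarrow> bool" where
  "is_chart T c \<longleftrightarrow>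
     chart_corner c \<le> chart_dim c \<and>
     openin T (chart_dom c) \<and>
     openin (sector (chart_corner c) (chart_dim c)) (chart_img c) \<and>
     homeomorphic_map (subtopology T (chart_dom c))
       (subtopology (sector (chart_corner c) (chart_dim c)) (chart_img c)) (chart_map c)"

text \<open>
  The atlas need not be maximal; it stands for the smooth structure it generates.  Different
  charts may have different dimensions, so that disjoint unions are again manifolds.
\<close>

record 'p mfd =
  mtop :: "'p topology"
  atlas :: "'p chart set"

abbreviation carrier :: "'p mfd \<Rightarrow> 'p set" where
  "carrier M \<equiv> topspace (mtop M)"

definition manifold_with_corners :: "'p mfd \<Rightarrow> bool" where
  "manifold_with_corners M \<longleftrightarrow>
     Hausdorff_space (mtop M) \<and> paracompact_space (mtop M) \<and>
     (\<forall>c\<in>atlas M. is_chart (mtop M) c) \<and>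
     (\<Union>c\<in>atlas M. chart_dom c) = carrier M \<and>
     (\<forall>c\<in>atlas M. \<forall>d\<in>atlas M.
        locally_extends_smoothly (chart_dim c) (chart_map c ` (chart_dom c \<inter> chart_dom d))
          (chart_dim d) (chart_map d \<circ> chart_inv c))"

definition smooth_map :: "'p mfd \<Rightarrow> 'q mfd \<Rightarrow> ('p \<Rightarrow> 'q) \<Rightarrow> bool" where
  "smooth_map M N f \<longleftrightarrow>
     continuous_map (mtop M) (mtop N) f \<and>
     (\<forall>c\<in>atlas M. \<forall>d\<in>atlas N.
        locally_extends_smoothly (chart_dim c) (chart_map c ` {p \<in> chart_dom c. f p \<in> chart_dom d})
          (chart_dim d) (chart_map d \<circ> f \<circ> chart_inv c))"

abbreviation vec1 :: "real \<Rightarrow> nat \<Rightarrow> real" where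
  "vec1 s \<equiv> (\<lambda>i. if i = 0 then s else 0)"

definition real_line :: "real mfd" where
  "real_line = \<lparr>mtop = euclideanreal,
     atlas = {\<lparr>chart_dim = 1, chart_corner = 0, chart_dom = UNIV, chart_map = vec1\<rparr>}\<rparr>"

definition interval_mfd :: "real \<Rightarrow> real \<Rightarrow> real mfd" where
  "interval_mfd u v = \<lparr>mtop = top_of_set {u..v},
     atlas = {\<lparr>chart_dim = 1, chart_corner = 1, chart_dom = {u..<v}, chart_map = (\<lambda>s. vec1 (s - u))\<rparr>,
              \<lparr>chart_dim = 1, chart_corner = 1, chart_dom = {u<..v}, chart_map = (\<lambda>s. vec1 (v - s))\<rparr>}\<rparr>"


section \<open>Tangent bundles and vector fields\<close>

definition smooth_functions :: "'p mfd \<Rightarrow> ('p \<Rightarrow> real) set" where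
  "smooth_functions M = {f \<in> extensional (carrier M). smooth_map M real_line f}"

text \<open>Tangent vectors at \<open>p\<close> are the derivations at \<open>p\<close> of the algebra of smooth functions.\<close>

definition tangent_space :: "'p mfd \<Rightarrow> 'p \<Rightarrow> (('p \<Rightarrow> real) \<Rightarrow> real) set" where
  "tangent_space M p = {v \<in> extensional (smooth_functions M).
     (\<forall>f\<in>smooth_functions M. \<forall>g\<in>smooth_functions M.
        v (\<lambda>x\<in>carrier M. f x + g x) = v f + v g \<and>
        v (\<lambda>x\<in>carrier M. f x * g x) = f p * v g + g p * v f) \<and>
     (\<forall>f\<in>smooth_functions M. \<forall>r. v (\<lambda>x\<in>carrier M. r * f x) = r * v f)}"

definition tangent_bundle :: "'p mfd \<Rightarrow> ('p \<times> (('p \<Rightarrow> real) \<Rightarrow> real)) set" where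
  "tangent_bundle M = (SIGMA p : carrier M. tangent_space M p)"

definition tangent_map :: "'p mfd \<Rightarrow> 'q mfd \<Rightarrow> ('p \<Rightarrow> 'q) \<Rightarrow>
    'p \<times> (('p \<Rightarrow> real) \<Rightarrow> real) \<Rightarrow> 'q \<times> (('q \<Rightarrow> real) \<Rightarrow> real)" where
  "tangent_map M N f = (\<lambda>(p, v).
     (f p, \<lambda>h\<in>smooth_functions N. v (compose (carrier M) h f)))"

text \<open>
  The derivative \<open>\<partial>f/\<partial>x\<^sub>i\<close> at \<open>p\<close> in a chart; it is one-sided where \<open>p\<close> lies
  on the \<open>i\<close>-th boundary face.
\<close>

definition chart_partial :: "'p chart \<Rightarrow> nat \<Rightarrow> 'p \<Rightarrow> ('p \<Rightarrow> real) \<Rightarrow> real" where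
  "chart_partial c i p f =
     vector_derivative (\<lambda>s. f (chart_inv c ((chart_map c p)(i := s))))
       (at (chart_map c p i) within {s. (chart_map c p)(i := s) \<in> chart_img c})"

text \<open>
  A vector field is a section of the tangent bundle that is smooth in the charts which the
  tangent bundle inherits from the atlas, i.e. in each chart it has the form
  \<open>\<Sum>\<^sub>i w\<^sub>i \<partial>/\<partial>x\<^sub>i\<close> with smooth coefficients \<open>w\<^sub>i\<close>.
\<close>

definition vector_field :: "'p mfd \<Rightarrow> ('p \<Rightarrow> 'p \<times> (('p \<Rightarrow> real) \<Rightarrow> real)) \<Rightarrow> bool" where
  "vector_field M X \<longleftrightarrow>
     (\<forall>p\<in>carrier M. X p \<in> tangent_bundle M \<and> fst (X p) = p) \<and>
     (\<forall>c\<in>atlas M. \<exists>w.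
        locally_extends_smoothly (chart_dim c) (chart_img c) (chart_dim c) w \<and>
        (\<forall>p\<in>chart_dom c. \<forall>f\<in>smooth_functions M.
           snd (X p) f = (\<Sum>i<chart_dim c. w (chart_map c p) i * chart_partial c i p f)))"

definition related :: "'p mfd \<Rightarrow> 'q mfd \<Rightarrow> ('p \<Rightarrow> 'q) \<Rightarrow>
    ('p \<Rightarrow> 'p \<times> (('p \<Rightarrow> real) \<Rightarrow> real)) \<Rightarrow> ('q \<Rightarrow> 'q \<times> (('q \<Rightarrow> real) \<Rightarrow> real)) \<Rightarrow> bool" where
  "related M N f X Y \<longleftrightarrow> (\<forall>p\<in>carrier M. tangent_map M N f (X p) = Y (f p))"


section \<open>Categories, functors and free categories\<close>

record ('o, 'm) cat =
  Ob :: "'o set"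
  Arr :: "'m set"
  Dom :: "'m \<Rightarrow> 'o"
  Cod :: "'m \<Rightarrow> 'o"
  Ident :: "'o \<Rightarrow> 'm"
  Comp :: "'m \<Rightarrow> 'm \<Rightarrow> 'm"  \<comment> \<open>\<open>Comp C g f\<close> is \<open>g\<close> after \<open>f\<close>\<close>

definition category :: "('o, 'm) cat \<Rightarrow> bool" where
  "category C \<longleftrightarrow>
     (\<forall>f\<in>Arr C. Dom C f \<in> Ob C \<and> Cod C f \<in> Ob C) \<and>
     (\<forall>x\<in>Ob C. Ident C x \<in> Arr C \<and> Dom C (Ident C x) = x \<and> Cod C (Ident C x) = x) \<and>
     (\<forall>f\<in>Arr C. \<forall>g\<in>Arr C. Cod C f = Dom C g \<longrightarrow>
        Comp C g f \<in> Arr C \<and> Dom C (Comp C g f) = Dom C f \<and> Cod C (Comp C g f) = Cod C g) \<and>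
     (\<forall>f\<in>Arr C. Comp C f (Ident C (Dom C f)) = f \<and> Comp C (Ident C (Cod C f)) f = f) \<and>
     (\<forall>f\<in>Arr C. \<forall>g\<in>Arr C. \<forall>h\<in>Arr C. Cod C f = Dom C g \<and> Cod C g = Dom C h \<longrightarrow>
        Comp C h (Comp C g f) = Comp C (Comp C h g) f)"

record ('o, 'm, 'u, 'n) cfunctor =
  on_ob :: "'o \<Rightarrow> 'u"
  on_arr :: "'m \<Rightarrow> 'n"

definition is_functor :: "('o, 'm) cat \<Rightarrow> ('u, 'n) cat \<Rightarrow> ('o, 'm, 'u, 'n) cfunctor \<Rightarrow> bool" where
  "is_functor C D F \<longleftrightarrow> category C \<and> category D \<and>
     (\<forall>x\<in>Ob C. on_ob F x \<in> Ob D \<and> on_arr F (Ident C x) = Ident D (on_ob F x)) \<and>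
     (\<forall>f\<in>Arr C. on_arr F f \<in> Arr D \<and>
        Dom D (on_arr F f) = on_ob F (Dom C f) \<and> Cod D (on_arr F f) = on_ob F (Cod C f)) \<and>
     (\<forall>f\<in>Arr C. \<forall>g\<in>Arr C. Cod C f = Dom C g \<longrightarrow>
        on_arr F (Comp C g f) = Comp D (on_arr F g) (on_arr F f))"

definition functor_comp ::
    "('u, 'n, 'w, 'l) cfunctor \<Rightarrow> ('o, 'm, 'u, 'n) cfunctor \<Rightarrow> ('o, 'm, 'w, 'l) cfunctor" where
  "functor_comp G F = \<lparr>on_ob = on_ob G \<circ> on_ob F, on_arr = on_arr G \<circ> on_arr F\<rparr>"

record ('v, 'e) dgraph =
  Vert :: "'v set"
  Edge :: "'e set"
  Src :: "'e \<Rightarrow> 'v"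
  Tgt :: "'e \<Rightarrow> 'v"

text \<open>A path is its initial vertex together with its list of edges, first edge first.\<close>

fun path_end :: "('v, 'e) dgraph \<Rightarrow> 'v \<Rightarrow> 'e list \<Rightarrow> 'v" where
  "path_end G x [] = x"
| "path_end G x (e # es) = path_end G (Tgt G e) es"

fun is_path :: "('v, 'e) dgraph \<Rightarrow> 'v \<Rightarrow> 'e list \<Rightarrow> bool" where
  "is_path G x [] \<longleftrightarrow> x \<in> Vert G"
| "is_path G x (e # es) \<longleftrightarrow> x \<in> Vert G \<and> e \<in> Edge G \<and> Src G e = x \<and> is_path G (Tgt G e) es"

definition free_cat :: "('v, 'e) dgraph \<Rightarrow> ('v, 'v \<times> 'e list) cat" where
  "free_cat G = \<lparr>Ob = Vert G, Arr = {(x, es). is_path G x es},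
     Dom = fst, Cod = (\<lambda>(x, es). path_end G x es), Ident = (\<lambda>x. (x, [])),
     Comp = (\<lambda>(y, es') (x, es). (x, es @ es'))\<rparr>"

fun extend_path :: "('v, 'e) dgraph \<Rightarrow> ('u, 'n) cat \<Rightarrow> ('v \<Rightarrow> 'u) \<Rightarrow> ('e \<Rightarrow> 'n) \<Rightarrow> 'v \<Rightarrow> 'e list \<Rightarrow> 'n" where
  "extend_path G C fo fe x [] = Ident C (fo x)"
| "extend_path G C fo fe x (e # es) = Comp C (extend_path G C fo fe (Tgt G e) es) (fe e)"

definition free_extension :: "('v, 'e) dgraph \<Rightarrow> ('u, 'n) cat \<Rightarrow> ('v \<Rightarrow> 'u) \<Rightarrow> ('e \<Rightarrow> 'n) \<Rightarrow>
    ('v, 'v \<times> 'e list, 'u, 'n) cfunctor" where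
  "free_extension G C fo fe =
     \<lparr>on_ob = fo, on_arr = (\<lambda>(x, es). extend_path G C fo fe x es)\<rparr>"


section \<open>Hybrid phase spaces\<close>

record 'p manrel =
  rel_dom :: "'p mfd"
  rel_cod :: "'p mfd"
  rel_graph :: "('p \<times> 'p) set"

definition RelMan :: "('p mfd, 'p manrel) cat" where
  "RelMan = \<lparr>Ob = {M. manifold_with_corners M},
     Arr = {R. manifold_with_corners (rel_dom R) \<and> manifold_with_corners (rel_cod R) \<and>
               rel_graph R \<subseteq> carrier (rel_dom R) \<times> carrier (rel_cod R)},
     Dom = rel_dom, Cod = rel_cod,
     Ident = (\<lambda>M. \<lparr>rel_dom = M, rel_cod = M, rel_graph = Id_on (carrier M)\<rparr>),
     Comp = (\<lambda>S R. \<lparr>rel_dom = rel_dom R, rel_cod = rel_cod S, rel_graph = rel_graph R O rel_graph S\<rparr>)\<rparr>"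

record ('o, 'm, 'p) hyph =
  base :: "('o, 'm) cat"
  phase :: "('o, 'm, 'p mfd, 'p manrel) cfunctor"

abbreviation phase_mfd :: "('o, 'm, 'p) hyph \<Rightarrow> 'o \<Rightarrow> 'p mfd" where
  "phase_mfd a x \<equiv> on_ob (phase a) x"

abbreviation phase_rel :: "('o, 'm, 'p) hyph \<Rightarrow> 'm \<Rightarrow> ('p \<times> 'p) set" where
  "phase_rel a \<gamma> \<equiv> rel_graph (on_arr (phase a) \<gamma>)"

definition hybrid_phase_space :: "('o, 'm, 'p) hyph \<Rightarrow> bool" where
  "hybrid_phase_space a \<longleftrightarrow> is_functor (base a) RelMan (phase a) \<and>
     Ob (base a) \<noteq> {} \<and> (\<forall>x\<in>Ob (base a). carrier (phase_mfd a x) \<noteq> {})"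

type_synonym ('o, 'm, 'p, 'u, 'n, 'q) hyph_map =
  "('o, 'm, 'u, 'n) cfunctor \<times> ('o \<Rightarrow> 'p \<Rightarrow> 'q)"

definition is_hyph_map ::
    "('o, 'm, 'p) hyph \<Rightarrow> ('u, 'n, 'q) hyph \<Rightarrow> ('o, 'm, 'p, 'u, 'n, 'q) hyph_map \<Rightarrow> bool" where
  "is_hyph_map a b = (\<lambda>(\<phi>, \<Phi>).
     hybrid_phase_space a \<and> hybrid_phase_space b \<and>
     is_functor (base a) (base b) \<phi> \<and>
     (\<forall>x\<in>Ob (base a). smooth_map (phase_mfd a x) (phase_mfd b (on_ob \<phi> x)) (\<Phi> x)) \<and>
     (\<forall>\<gamma>\<in>Arr (base a).
        map_prod (\<Phi> (Dom (base a) \<gamma>)) (\<Phi> (Cod (base a) \<gamma>)) ` phase_rel a \<gamma>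
          \<subseteq> phase_rel b (on_arr \<phi> \<gamma>)))"

definition hyph_comp :: "('u, 'n, 'q, 'w, 'l, 'r) hyph_map \<Rightarrow> ('o, 'm, 'p, 'u, 'n, 'q) hyph_map \<Rightarrow>
    ('o, 'm, 'p, 'w, 'l, 'r) hyph_map" where
  "hyph_comp = (\<lambda>(\<psi>, \<Psi>) (\<phi>, \<Phi>). (functor_comp \<psi> \<phi>, \<lambda>x. \<Psi> (on_ob \<phi> x) \<circ> \<Phi> x))"

text \<open>The functor $\mathbb{U}$ on objects (disjoint union of manifolds) and on maps.\<close>

definition U_ob :: "('o, 'm, 'p) hyph \<Rightarrow> ('o \<times> 'p) mfd" where
  "U_ob a = \<lparr>mtop = sum_topology (\<lambda>x. mtop (phase_mfd a x)) (Ob (base a)),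
     atlas = (\<Union>x\<in>Ob (base a). (\<lambda>c. \<lparr>chart_dim = chart_dim c, chart_corner = chart_corner c,
        chart_dom = {x} \<times> chart_dom c, chart_map = chart_map c \<circ> snd\<rparr>) ` atlas (phase_mfd a x))\<rparr>"

definition U_map :: "('o, 'm, 'p, 'u, 'n, 'q) hyph_map \<Rightarrow> 'o \<times> 'p \<Rightarrow> 'u \<times> 'q" where
  "U_map = (\<lambda>(\<phi>, \<Phi>) (x, p). (on_ob \<phi> x, \<Phi> x p))"


section \<open>Hybrid dynamical systems and executions\<close>

type_synonym ('o, 'm, 'p) hds =
  "('o, 'm, 'p) hyph \<times> ('o \<times> 'p \<Rightarrow> ('o \<times> 'p) \<times> (('o \<times> 'p \<Rightarrow> real) \<Rightarrow> real))"

definition hybrid_dynamical_system :: "('o, 'm, 'p) hds \<Rightarrow> bool" where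
  "hybrid_dynamical_system = (\<lambda>(a, X). hybrid_phase_space a \<and> vector_field (U_ob a) X)"

definition is_hds_map ::
    "('o, 'm, 'p) hds \<Rightarrow> ('u, 'n, 'q) hds \<Rightarrow> ('o, 'm, 'p, 'u, 'n, 'q) hyph_map \<Rightarrow> bool" where
  "is_hds_map = (\<lambda>(a, X) (b, Y) f.
     hybrid_dynamical_system (a, X) \<and> hybrid_dynamical_system (b, Y) \<and>
     is_hyph_map a b f \<and> related (U_ob a) (U_ob b) (U_map f) X Y)"

definition time_graph :: "(nat, nat) dgraph" where
  "time_graph = \<lparr>Vert = UNIV, Edge = UNIV, Src = (\<lambda>i. i), Tgt = Suc\<rparr>"

definition exec_hyph :: "(nat \<Rightarrow> real) \<Rightarrow> (nat, nat \<times> nat list, real) hyph" where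
  "exec_hyph t = \<lparr>base = free_cat time_graph,
     phase = free_extension time_graph RelMan
       (\<lambda>i. interval_mfd (t i) (t (Suc i)))
       (\<lambda>i. \<lparr>rel_dom = interval_mfd (t i) (t (Suc i)),
             rel_cod = interval_mfd (t (Suc i)) (t (Suc (Suc i))),
             rel_graph = {(t (Suc i), t (Suc i))}\<rparr>)\<rparr>"

definition exec_field :: "(nat \<Rightarrow> real) \<Rightarrow>
    nat \<times> real \<Rightarrow> (nat \<times> real) \<times> ((nat \<times> real \<Rightarrow> real) \<Rightarrow> real)" where
  "exec_field t = (\<lambda>(i, s). ((i, s), \<lambda>f\<in>smooth_functions (U_ob (exec_hyph t)).
     vector_derivative (\<lambda>r. f (i, r)) (at s within {t i..t (Suc i)})))"

text \<open>
  ``Increasing'' is strict: otherwise some interval is a point, on which $d/dt$ is meaningless.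
\<close>

definition is_execution :: "('o, 'm, 'p) hds \<Rightarrow> (nat \<Rightarrow> real) \<Rightarrow>
    (nat, nat \<times> nat list, real, 'o, 'm, 'p) hyph_map \<Rightarrow> bool" where
  "is_execution A t f \<longleftrightarrow> strict_mono t \<and> is_hds_map (exec_hyph t, exec_field t) A f"

end

theory Submission
  imports Defs
begin

text \<open>
  An execution of a hybrid dynamical system is a map into it from the system of time intervals with
  the vector field $d/dt$, so the theorem says that maps of hybrid dynamical systems compose
  (\<open>is_hds_map_hyph_comp\<close>).  Functors compose, and the inclusions of relations can be chained.
  What has to be shown is that the composite is smooth on each manifold, and that relatedness of
  vector fields passes to it.

  If \<open>Y\<close> is \<open>f\<close>-related to \<open>X\<close> and \<open>Z\<close> is \<open>g\<close>-related to \<open>Y\<close>, then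
  $T(g \circ f) \circ X = Tg \circ Tf \circ X = Tg \circ Y \circ f = Z \circ g \circ f$
  (\<open>related_compose\<close>).  With derivations as tangent vectors, $T(g \circ f) = Tg \circ Tf$ requires
  that smooth functions pull back to smooth functions along \<open>g\<close> (\<open>tangent_map_compose\<close>).
  Here \<open>g\<close> is the map induced on disjoint unions, which is smooth because each of its components
  is (\<open>smooth_map_U_map\<close>).

  Both points thus rest on the fact that composites of smooth maps between manifolds with corners
  are smooth (\<open>smooth_map_compose\<close>).  In charts this becomes the corresponding fact about open
  subsets of Euclidean spaces.  Smoothness there means that iterated partial derivatives exist and
  are continuous, so the fact follows by induction on the order of differentiation
  (\<open>Ck_on_compose\<close>) from the chain rule for functions with continuous partial derivatives
  (\<open>chain_rule_partials\<close>).
\<close>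

section \<open>The chain rule from continuous partial derivatives\<close>

text \<open>
  The topology of \<^const>\<open>Euclidean_space\<close> is inherited from the product of infinitely many lines;
  since all but finitely many coordinates are zero, open sets are detected by finite boxes.
\<close>

lemma openin_Euclidean_space_box:
  assumes W: "openin (Euclidean_space n) W" and x: "x \<in> W"
  shows "\<exists>e>0. \<forall>y\<in>topspace (Euclidean_space n). (\<forall>i<n. \<bar>y i - x i\<bar> < e) \<longrightarrow> y \<in> W"
proof -
  obtain T where T: "openin (powertop_real UNIV) T" and WT: "W = T \<inter> {x. \<forall>i\<ge>n. x i = 0}"
    using W unfolding Euclidean_space_def openin_subtopology by blast
  obtain U where U: "x \<in> Pi\<^sub>E UNIV U" "\<And>i. open (U i)" "Pi\<^sub>E UNIV U \<subseteq> T"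
    using product_topology_open_contains_basis[OF T, of x] x WT by auto
  have "\<exists>e>0. \<forall>r. \<bar>r - x i\<bar> < e \<longrightarrow> r \<in> U i" for i
    using U(1) U(2)[of i] unfolding open_dist by (auto simp: dist_real_def)
  then obtain e where e: "\<And>i. e i > 0" "\<And>i r. \<bar>r - x i\<bar> < e i \<Longrightarrow> r \<in> U i"
    by metis
  define d where "d = Min (insert 1 (e ` {..<n}))"
  have "d > 0"
    unfolding d_def using e(1) by (subst Min_gr_iff) auto
  moreover have "y \<in> W" if y: "y \<in> topspace (Euclidean_space n)"
    and close: "\<And>i. i < n \<Longrightarrow> \<bar>y i - x i\<bar> < d" for y
  proof -
    have "y i \<in> U i" for i
    proof (cases "i < n")
      case True
      then have "d \<le> e i" unfolding d_def by (intro Min_le) auto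
      with close[OF True] e(2) show ?thesis by force
    next
      case False
      then have "y i = x i"
        using y x WT by (auto simp: topspace_Euclidean_space)
      then show ?thesis using e by auto
    qed
    then show ?thesis
      using U(3) y WT by (auto simp: topspace_Euclidean_space)
  qed
  ultimately show ?thesis by blast
qed

lemma real_mvt_between:
  fixes f :: "real \<Rightarrow> real"
  assumes "\<And>r. min a b \<le> r \<Longrightarrow> r \<le> max a b \<Longrightarrow> (f has_real_derivative f' r) (at r)"
  obtains r where "min a b \<le> r" "r \<le> max a b" "f b - f a = f' r * (b - a)"
proof (cases a b rule: linorder_cases)
  case less
  then obtain z where "z > a" "z < b" "f b - f a = (b - a) * f' z"
    using MVT2[of a b f f'] assms by auto
  then show ?thesis using that[of z] less by (simp add: mult.commute)
next
  case equal
  then show ?thesis using that[of a] by simp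
next
  case greater
  then obtain z where "z > b" "z < a" "f a - f b = (a - b) * f' z"
    using MVT2[of b a f f'] assms by auto
  then show ?thesis using that[of z] greater by (simp add: algebra_simps)
qed

text \<open>
  The chain rule along a curve, from continuous partial derivatives alone.  The increment
  \<open>G (u s) - G (u s0)\<close> telescopes over the points \<open>P k s\<close> that have their first \<open>k\<close> coordinates
  moved to \<open>u s\<close> and the others left at \<open>u s0\<close>.  Each summand varies a single coordinate, so the
  mean value theorem turns it into a value of \<open>g k\<close> near \<open>u s0\<close> times the increment of that
  coordinate.
\<close>

lemma chain_rule_partials:
  fixes u :: "real \<Rightarrow> nat \<Rightarrow> real"
  assumes W: "openin (Euclidean_space n) W"
    and partial: "\<And>j y. j < n \<Longrightarrow> y \<in> W \<Longrightarrow>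
      ((\<lambda>s. G (y(j := s))) has_real_derivative g j y) (at (y j))"
    and cont: "\<And>j. j < n \<Longrightarrow> continuous_map (subtopology (Euclidean_space n) W) euclideanreal (g j)"
    and u0: "u s0 \<in> W"
    and u: "\<forall>\<^sub>F s in at s0. u s \<in> topspace (Euclidean_space n)"
    and du: "\<And>j. j < n \<Longrightarrow> ((\<lambda>s. u s j) has_real_derivative d j) (at s0)"
  shows "((\<lambda>s. G (u s)) has_real_derivative (\<Sum>j<n. g j (u s0) * d j)) (at s0)"
proof -
  define P where "P k s = (\<lambda>i. if i < k then u s i else u s0 i)" for k s
  have WE: "W \<subseteq> topspace (Euclidean_space n)"
    using W by (rule openin_subset)
  have P_s0: "P k s0 = u s0" for k
    by (auto simp: P_def)
  have "((\<lambda>s. G (P k s)) has_real_derivative (\<Sum>j<k. g j (u s0) * d j)) (at s0)" if "k \<le> n" for k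
    using that
  proof (induction k)
    case 0
    then show ?case by (simp add: P_def)
  next
    case (Suc k)
    then have k: "k < n" by simp
    define D where "D s = G (P (Suc k) s) - G (P k s)" for s
    \<comment> \<open>Where coordinate \<open>k\<close> does not move, the quotient gets its intended limit; the chain rule
      thus needs no case distinction on whether \<open>u\<close> returns to its initial value.\<close>
    define q where
      "q s = (if u s k = u s0 k then g k (u s0) else D s / (u s k - u s0 k))" for s
    have fac: "D s = q s * (u s k - u s0 k)" for s
    proof (cases "u s k = u s0 k")
      case True
      then have "P (Suc k) s = P k s"
        by (auto simp: P_def less_Suc_eq)
      with True show ?thesis by (simp add: D_def)
    qed (simp add: q_def)
    have "(q \<longlongrightarrow> g k (u s0)) (at s0)"
    proof (rule tendstoI)
      fix \<epsilon> :: real assume "\<epsilon> > 0"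
      let ?V = "{y \<in> W. g k y \<in> ball (g k (u s0)) \<epsilon>}"
      have "openin (subtopology (Euclidean_space n) W) ?V"
        using openin_continuous_map_preimage[OF cont[OF k], of "ball (g k (u s0)) \<epsilon>"] WE
        by (simp add: inf.absorb2)
      then have "openin (Euclidean_space n) ?V"
        using W openin_trans_full by blast
      moreover have "u s0 \<in> ?V"
        using u0 \<open>\<epsilon> > 0\<close> by simp
      ultimately obtain e where e: "e > 0" "\<And>y. y \<in> topspace (Euclidean_space n) \<Longrightarrow>
          (\<And>i. i < n \<Longrightarrow> \<bar>y i - u s0 i\<bar> < e) \<Longrightarrow> y \<in> ?V"
        using openin_Euclidean_space_box[of n ?V "u s0"] by blast
      have "\<forall>\<^sub>F s in at s0. \<bar>u s i - u s0 i\<bar> < e" if "i < n" for i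
      proof -
        have "((\<lambda>s. u s i) \<longlongrightarrow> u s0 i) (at s0)"
          using DERIV_isCont[OF du[OF that]] by (simp add: isCont_def)
        then show ?thesis
          using tendstoD[of "\<lambda>s. u s i" "u s0 i" "at s0" e] e(1) by (simp add: dist_real_def)
      qed
      then have "\<forall>\<^sub>F s in at s0. \<forall>i\<in>{..<n}. \<bar>u s i - u s0 i\<bar> < e"
        by (intro eventually_ball_finite) auto
      then show "\<forall>\<^sub>F s in at s0. dist (q s) (g k (u s0)) < \<epsilon>"
      proof (rule eventually_mono)
        fix s assume s: "\<forall>i\<in>{..<n}. \<bar>u s i - u s0 i\<bar> < e"
        let ?y = "\<lambda>r. (P k s)(k := r)"
        have y: "?y r \<in> ?V" if "min (u s0 k) (u s k) \<le> r" "r \<le> max (u s0 k) (u s k)" for r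
        proof (rule e(2))
          show "?y r \<in> topspace (Euclidean_space n)"
            using u0 WE k by (auto simp: P_def topspace_Euclidean_space)
          have "\<bar>r - u s0 k\<bar> \<le> \<bar>u s k - u s0 k\<bar>"
            using that by linarith
          then show "\<bar>?y r i - u s0 i\<bar> < e" if "i < n" for i
            using s k that e(1) by (auto simp: P_def intro: le_less_trans)
        qed
        have "((\<lambda>r. G (?y r)) has_real_derivative g k (?y r)) (at r)"
          if "min (u s0 k) (u s k) \<le> r" "r \<le> max (u s0 k) (u s k)" for r
          using partial[OF k, of "?y r"] y[OF that] by simp
        then obtain r where r: "min (u s0 k) (u s k) \<le> r" "r \<le> max (u s0 k) (u s k)"
          and "G (?y (u s k)) - G (?y (u s0 k)) = g k (?y r) * (u s k - u s0 k)"
          by (rule real_mvt_between)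
        moreover have "?y (u s k) = P (Suc k) s" "?y (u s0 k) = P k s"
          by (auto simp: P_def)
        ultimately have "D s = g k (?y r) * (u s k - u s0 k)"
          by (simp add: D_def)
        then have "q s = g k (u s0) \<or> q s = g k (?y r)"
          by (simp add: q_def)
        then show "dist (q s) (g k (u s0)) < \<epsilon>"
          using y[OF r] \<open>\<epsilon> > 0\<close> by (auto simp: dist_commute)
      qed
    qed
    moreover have "((\<lambda>s. (u s k - u s0 k) / (s - s0)) \<longlongrightarrow> d k) (at s0)"
      using du[OF k] by (simp add: has_field_derivative_iff)
    ultimately have "((\<lambda>s. q s * ((u s k - u s0 k) / (s - s0))) \<longlongrightarrow> g k (u s0) * d k) (at s0)"
      by (rule tendsto_mult)
    then have "(D has_real_derivative g k (u s0) * d k) (at s0)"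
      unfolding has_field_derivative_iff by (simp add: fac)
    from DERIV_add[OF Suc.IH this] k show ?case
      by (simp add: D_def)
  qed
  from this[of n] have "((\<lambda>s. G (P n s)) has_real_derivative (\<Sum>j<n. g j (u s0) * d j)) (at s0)"
    by simp
  \<comment> \<open>\<open>P n s\<close> keeps the coordinates of \<open>u s0\<close> from index \<open>n\<close> on, all of which vanish.\<close>
  moreover have "\<forall>\<^sub>F s in nhds s0. G (P n s) = G (u s)"
    unfolding eventually_nhds_conv_at
  proof
    have "P n s = u s" if "u s \<in> topspace (Euclidean_space n)" for s
      using that u0 WE by (force simp: P_def topspace_Euclidean_space)
    then show "\<forall>\<^sub>F s in at s0. G (P n s) = G (u s)"
      using u by (auto elim: eventually_mono)
    show "G (P n s0) = G (u s0)"
      by (simp add: P_s0)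
  qed
  ultimately show ?thesis
    by (simp add: DERIV_cong_ev)
qed

section \<open>The calculus of functions of class $C^k$\<close>

lemma Ck_on_imp_continuous_map:
  "Ck_on k n W f \<Longrightarrow> continuous_map (subtopology (Euclidean_space n) W) euclideanreal f"
  by (cases k) auto

lemma Ck_on_SucI:
  assumes "continuous_map (subtopology (Euclidean_space n) W) euclideanreal f"
    and "\<And>i. i < n \<Longrightarrow> \<exists>g. Ck_on k n W g \<and>
      (\<forall>x\<in>W. ((\<lambda>s. f (x(i := s))) has_real_derivative g x) (at (x i)))"
  shows "Ck_on (Suc k) n W f"
  using assms by simp

lemma Ck_on_Suc_partials:
  assumes "Ck_on (Suc k) n W f"
  obtains g where "\<And>i. i < n \<Longrightarrow> Ck_on k n W (g i)"
    "\<And>i x. i < n \<Longrightarrow> x \<in> W \<Longrightarrow> ((\<lambda>s. f (x(i := s))) has_real_derivative g i x) (at (x i))"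
proof -
  have "\<forall>i. \<exists>g. i < n \<longrightarrow> Ck_on k n W g \<and>
      (\<forall>x\<in>W. ((\<lambda>s. f (x(i := s))) has_real_derivative g x) (at (x i)))"
    using assms by auto
  then obtain g where "\<And>i. i < n \<longrightarrow> Ck_on k n W (g i) \<and>
      (\<forall>x\<in>W. ((\<lambda>s. f (x(i := s))) has_real_derivative g i x) (at (x i)))"
    unfolding choice_iff by blast
  then show ?thesis by (intro that[of g]) blast+
qed

lemma Ck_on_SucD: "Ck_on (Suc k) n W f \<Longrightarrow> Ck_on k n W f"
proof (induction k arbitrary: f)
  case 0
  then show ?case by simp
next
  case (Suc k)
  obtain g where g: "\<And>i. i < n \<Longrightarrow> Ck_on (Suc k) n W (g i)"
    "\<And>i x. i < n \<Longrightarrow> x \<in> W \<Longrightarrow> ((\<lambda>s. f (x(i := s))) has_real_derivative g i x) (at (x i))"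
    using Ck_on_Suc_partials[OF Suc.prems] by blast
  show ?case
  proof (rule Ck_on_SucI)
    show "continuous_map (subtopology (Euclidean_space n) W) euclideanreal f"
      using Suc.prems by (rule Ck_on_imp_continuous_map)
  qed (use g Suc.IH in blast)
qed

lemma Ck_on_subset:
  assumes "Ck_on k n W f" "V \<subseteq> W"
  shows "Ck_on k n V f"
  using assms
proof (induction k arbitrary: f)
  case 0
  then show ?case
    using continuous_map_from_subtopology_mono by (metis Ck_on.simps(1))
next
  case (Suc k)
  obtain g where g: "\<And>i. i < n \<Longrightarrow> Ck_on k n W (g i)"
    "\<And>i x. i < n \<Longrightarrow> x \<in> W \<Longrightarrow> ((\<lambda>s. f (x(i := s))) has_real_derivative g i x) (at (x i))"
    using Ck_on_Suc_partials[OF Suc.prems(1)] by blast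
  show ?case
  proof (rule Ck_on_SucI)
    show "continuous_map (subtopology (Euclidean_space n) V) euclideanreal f"
      using Suc.prems Ck_on_imp_continuous_map continuous_map_from_subtopology_mono by metis
  qed (use g Suc in blast)
qed

lemma Ck_on_const: "Ck_on k n W (\<lambda>x. c)"
proof (induction k arbitrary: c)
  case (Suc k)
  show ?case
    by (rule Ck_on_SucI) (auto intro!: exI[of _ "\<lambda>x. 0"] Suc.IH)
qed simp

lemma Ck_on_add:
  "Ck_on k n W f \<Longrightarrow> Ck_on k n W g \<Longrightarrow> Ck_on k n W (\<lambda>x. f x + g x)"
proof (induction k arbitrary: f g)
  case 0
  then show ?case by (simp add: continuous_map_add)
next
  case (Suc k)
  obtain f' where f': "\<And>i. i < n \<Longrightarrow> Ck_on k n W (f' i)"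
    "\<And>i x. i < n \<Longrightarrow> x \<in> W \<Longrightarrow> ((\<lambda>s. f (x(i := s))) has_real_derivative f' i x) (at (x i))"
    using Ck_on_Suc_partials[OF Suc.prems(1)] by blast
  obtain g' where g': "\<And>i. i < n \<Longrightarrow> Ck_on k n W (g' i)"
    "\<And>i x. i < n \<Longrightarrow> x \<in> W \<Longrightarrow> ((\<lambda>s. g (x(i := s))) has_real_derivative g' i x) (at (x i))"
    using Ck_on_Suc_partials[OF Suc.prems(2)] by blast
  show ?case
  proof (rule Ck_on_SucI)
    show "continuous_map (subtopology (Euclidean_space n) W) euclideanreal (\<lambda>x. f x + g x)"
      using Suc.prems[THEN Ck_on_imp_continuous_map] by (rule continuous_map_add)
    fix i assume i: "i < n"
    have "Ck_on k n W (\<lambda>x. f' i x + g' i x)"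
      by (intro Suc.IH f'(1) g'(1) i)
    moreover have "((\<lambda>s. f (x(i := s)) + g (x(i := s))) has_real_derivative
        f' i x + g' i x) (at (x i))" if "x \<in> W" for x
      using DERIV_add[OF f'(2) g'(2), OF i that i that] .
    ultimately show "\<exists>h. Ck_on k n W h \<and> (\<forall>x\<in>W.
        ((\<lambda>s. f (x(i := s)) + g (x(i := s))) has_real_derivative h x) (at (x i)))"
      by blast
  qed
qed

lemma Ck_on_sum:
  "(\<And>j. j \<in> J \<Longrightarrow> Ck_on k n W (f j)) \<Longrightarrow> Ck_on k n W (\<lambda>x. \<Sum>j\<in>J. f j x)"
  by (induction J rule: infinite_finite_induct) (simp_all add: Ck_on_const Ck_on_add)

lemma Ck_on_mult:
  "Ck_on k n W f \<Longrightarrow> Ck_on k n W g \<Longrightarrow> Ck_on k n W (\<lambda>x. f x * g x)"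
proof (induction k arbitrary: f g)
  case 0
  then show ?case by (simp add: continuous_map_real_mult)
next
  case (Suc k)
  obtain f' where f': "\<And>i. i < n \<Longrightarrow> Ck_on k n W (f' i)"
    "\<And>i x. i < n \<Longrightarrow> x \<in> W \<Longrightarrow> ((\<lambda>s. f (x(i := s))) has_real_derivative f' i x) (at (x i))"
    using Ck_on_Suc_partials[OF Suc.prems(1)] by blast
  obtain g' where g': "\<And>i. i < n \<Longrightarrow> Ck_on k n W (g' i)"
    "\<And>i x. i < n \<Longrightarrow> x \<in> W \<Longrightarrow> ((\<lambda>s. g (x(i := s))) has_real_derivative g' i x) (at (x i))"
    using Ck_on_Suc_partials[OF Suc.prems(2)] by blast
  show ?case
  proof (rule Ck_on_SucI)
    show "continuous_map (subtopology (Euclidean_space n) W) euclideanreal (\<lambda>x. f x * g x)"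
      using Suc.prems[THEN Ck_on_imp_continuous_map] by (rule continuous_map_real_mult)
    fix i assume i: "i < n"
    have "Ck_on k n W (\<lambda>x. f' i x * g x + g' i x * f x)"
      by (intro Ck_on_add Suc.IH f'(1) g'(1) i Suc.prems[THEN Ck_on_SucD])
    moreover have "((\<lambda>s. f (x(i := s)) * g (x(i := s))) has_real_derivative
        f' i x * g x + g' i x * f x) (at (x i))" if "x \<in> W" for x
      using DERIV_mult[OF f'(2) g'(2), OF i that i that] by simp
    ultimately show "\<exists>h. Ck_on k n W h \<and> (\<forall>x\<in>W.
        ((\<lambda>s. f (x(i := s)) * g (x(i := s))) has_real_derivative h x) (at (x i)))"
      by blast
  qed
qed

lemma continuous_map_into_Euclidean_space:
  assumes F: "F ` topspace T \<subseteq> topspace (Euclidean_space n)"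
    and "\<And>j. j < n \<Longrightarrow> continuous_map T euclideanreal (\<lambda>x. F x j)"
  shows "continuous_map T (Euclidean_space n) F"
proof -
  have "continuous_map T (Euclidean_space n) (\<lambda>x i. if i < n then F x i else 0)"
    using assms(2) continuous_map_componentwise_Euclidean_space by blast
  moreover have "(\<lambda>i. if i < n then F x i else 0) = F x" if "x \<in> topspace T" for x
    using F that by (force simp: topspace_Euclidean_space)
  ultimately show ?thesis
    by (rule continuous_map_eq)
qed

lemma continuous_map_Ck_on_components:
  assumes "F ` W \<subseteq> topspace (Euclidean_space n)"
    and "\<And>j. j < n \<Longrightarrow> Ck_on k m W (\<lambda>x. F x j)"
  shows "continuous_map (subtopology (Euclidean_space m) W) (Euclidean_space n) F"
proof (rule continuous_map_into_Euclidean_space)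
  show "continuous_map (subtopology (Euclidean_space m) W) euclideanreal (\<lambda>x. F x j)"
    if "j < n" for j
    using assms(2)[OF that] by (rule Ck_on_imp_continuous_map)
qed (use assms(1) in auto)

text \<open>
  By the chain rule the partial derivatives of \<open>G \<circ> F\<close> are sums of products of functions of one
  class lower, among them the composites of the partial derivatives of \<open>G\<close> with \<open>F\<close>; so
  induction on \<open>k\<close> applies, with \<open>G\<close> arbitrary and \<open>F\<close> fixed.
\<close>

lemma Ck_on_compose:
  assumes W: "openin (Euclidean_space m) W" and V: "openin (Euclidean_space n) V"
    and FV: "F ` W \<subseteq> V"
    and F: "\<And>j. j < n \<Longrightarrow> Ck_on k m W (\<lambda>x. F x j)"
    and G: "Ck_on k n V G"
  shows "Ck_on k m W (\<lambda>x. G (F x))"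
proof -
  have "F ` W \<subseteq> topspace (Euclidean_space n)"
    using FV openin_subset[OF V] by blast
  then have cont: "continuous_map (subtopology (Euclidean_space m) W) (subtopology (Euclidean_space n) V) F"
    using FV continuous_map_Ck_on_components[of F W n k m, OF _ F]
    by (auto simp: continuous_map_in_subtopology)
  show ?thesis
    using F G
  proof (induction k arbitrary: G)
    case 0
    then show ?case
      using continuous_map_compose[OF cont 0(2)[unfolded Ck_on.simps(1)]] by (simp add: o_def)
  next
    case (Suc k)
    have WE: "W \<subseteq> topspace (Euclidean_space m)" and VE: "V \<subseteq> topspace (Euclidean_space n)"
      using W V by (auto dest: openin_subset)
    define Q where "Q j f \<longleftrightarrow> (\<forall>i<m. Ck_on k m W (f i) \<and> (\<forall>x\<in>W.
        ((\<lambda>s. F (x(i := s)) j) has_real_derivative f i x) (at (x i))))" for j f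
    have "\<exists>f. Q j f" if j: "j < n" for j
    proof -
      obtain h where "\<And>i. i < m \<Longrightarrow> Ck_on k m W (h i)"
        "\<And>i x. i < m \<Longrightarrow> x \<in> W \<Longrightarrow> ((\<lambda>s. F (x(i := s)) j) has_real_derivative h i x) (at (x i))"
        using Ck_on_Suc_partials[OF Suc.prems(1)[OF j]] by blast
      then have "Q j h"
        by (simp add: Q_def)
      then show ?thesis by (rule exI[of "Q j" h])
    qed
    then obtain f where "\<And>j. j < n \<Longrightarrow> Q j (f j)"
      by metis
    then have f: "\<And>i j. j < n \<Longrightarrow> i < m \<Longrightarrow> Ck_on k m W (f j i)"
      "\<And>i j x. j < n \<Longrightarrow> i < m \<Longrightarrow> x \<in> W \<Longrightarrow>
        ((\<lambda>s. F (x(i := s)) j) has_real_derivative f j i x) (at (x i))"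
      by (simp_all add: Q_def)
    obtain g where g: "\<And>j. j < n \<Longrightarrow> Ck_on k n V (g j)"
      "\<And>j y. j < n \<Longrightarrow> y \<in> V \<Longrightarrow> ((\<lambda>s. G (y(j := s))) has_real_derivative g j y) (at (y j))"
      using Ck_on_Suc_partials[OF Suc.prems(2)] by blast
    show ?case
    proof (rule Ck_on_SucI)
      show "continuous_map (subtopology (Euclidean_space m) W) euclideanreal (\<lambda>x. G (F x))"
        using continuous_map_compose[OF cont Ck_on_imp_continuous_map[OF Suc.prems(2)]]
        by (simp add: o_def)
      fix i assume i: "i < m"
      have "Ck_on k m W (\<lambda>x. \<Sum>j<n. g j (F x) * f j i x)"
      proof (rule Ck_on_sum)
        fix j assume "j \<in> {..<n}"
        then have j: "j < n" by simp
        have "Ck_on k m W (\<lambda>x. g j (F x))"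
          using Suc.prems(1)[THEN Ck_on_SucD] g(1)[OF j] by (rule Suc.IH)
        then show "Ck_on k m W (\<lambda>x. g j (F x) * f j i x)"
          using f(1)[OF j i] by (rule Ck_on_mult)
      qed
      moreover have "((\<lambda>s. G (F (x(i := s)))) has_real_derivative
          (\<Sum>j<n. g j (F x) * f j i x)) (at (x i))" if x: "x \<in> W" for x
      proof -
        obtain e where e: "e > 0" "\<And>y. y \<in> topspace (Euclidean_space m) \<Longrightarrow>
            (\<forall>l<m. \<bar>y l - x l\<bar> < e) \<Longrightarrow> y \<in> W"
          using openin_Euclidean_space_box[OF W x] by blast
        have "x(i := s) \<in> W" if "dist s (x i) < e" for s
          using e(1) x WE i that
          by (intro e(2)) (auto simp: topspace_Euclidean_space dist_real_def)
        then have "\<forall>\<^sub>F s in at (x i). F (x(i := s)) \<in> topspace (Euclidean_space n)"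
          unfolding eventually_at using e(1) FV VE by blast
        moreover have "F (x(i := x i)) \<in> V"
          using FV x by auto
        ultimately have "((\<lambda>s. G (F (x(i := s)))) has_real_derivative
            (\<Sum>j<n. g j (F (x(i := x i))) * f j i x)) (at (x i))"
          using f(2)[OF _ i x]
          by (intro chain_rule_partials[OF V g(2) Ck_on_imp_continuous_map[OF g(1)]])
        then show ?thesis
          by simp
      qed
      ultimately show "\<exists>h. Ck_on k m W h \<and> (\<forall>x\<in>W.
          ((\<lambda>s. G (F (x(i := s)))) has_real_derivative h x) (at (x i)))"
        by blast
    qed
  qed
qed

section \<open>Smooth extensions\<close>

lemma smooth_open_subset:
  assumes "smooth_open m W n F" "openin (Euclidean_space m) V" "V \<subseteq> W"
  shows "smooth_open m V n F"
  using assms unfolding smooth_open_def by (blast intro: Ck_on_subset)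

lemma smooth_open_imp_continuous_map:
  assumes "smooth_open m W n F"
  shows "continuous_map (subtopology (Euclidean_space m) W) (Euclidean_space n) F"
  using assms unfolding smooth_open_def by (blast intro: continuous_map_Ck_on_components)

lemma smooth_open_compose:
  assumes F: "smooth_open m W n F" and G: "smooth_open n V p G" and FV: "F ` W \<subseteq> V"
  shows "smooth_open m W p (G \<circ> F)"
  unfolding smooth_open_def
proof (intro conjI allI impI)
  show W: "openin (Euclidean_space m) W"
    using F by (simp add: smooth_open_def)
  show "(G \<circ> F) ` W \<subseteq> topspace (Euclidean_space p)"
    using G FV by (auto simp: smooth_open_def)
  show "Ck_on k m W (\<lambda>x. (G \<circ> F) x j)" if "j < p" for j k
    unfolding o_apply
  proof (rule Ck_on_compose[OF W _ FV])
    show "openin (Euclidean_space n) V" "Ck_on k n V (\<lambda>y. G y j)"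
      using G that by (simp_all add: smooth_open_def)
    show "Ck_on k m W (\<lambda>x. F x i)" if "i < n" for i
      using F that by (simp add: smooth_open_def)
  qed
qed

lemma locally_extends_smoothly_subset:
  assumes "locally_extends_smoothly m A n g" "B \<subseteq> A"
  shows "locally_extends_smoothly m B n g"
  unfolding locally_extends_smoothly_def
proof
  fix x assume "x \<in> B"
  then obtain W F where "x \<in> W" "smooth_open m W n F" "\<forall>y\<in>W \<inter> A. F y = g y"
    using assms unfolding locally_extends_smoothly_def by blast
  then show "\<exists>W F. x \<in> W \<and> smooth_open m W n F \<and> (\<forall>y\<in>W \<inter> B. F y = g y)"
    using assms(2) by blast
qed

lemma locally_extends_smoothly_cong:
  "(\<And>x. x \<in> A \<Longrightarrow> f x = g x) \<Longrightarrow>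
    locally_extends_smoothly m A n f \<longleftrightarrow> locally_extends_smoothly m A n g"
  by (simp add: locally_extends_smoothly_def)

text \<open>
  Local extensions \<open>F\<close> of \<open>f\<close> and \<open>G\<close> of \<open>g\<close> compose after shrinking the domain of \<open>F\<close> to the
  preimage of the domain of \<open>G\<close>.  The values of \<open>F\<close> off \<open>A\<close> may leave \<open>B\<close>, but only points of
  \<open>A\<close> matter for the comparison with \<open>g \<circ> f\<close>.
\<close>

lemma locally_extends_smoothly_compose:
  assumes f: "locally_extends_smoothly m A n f" and g: "locally_extends_smoothly n B p g"
    and AB: "f ` A \<subseteq> B"
  shows "locally_extends_smoothly m A p (g \<circ> f)"
  unfolding locally_extends_smoothly_def
proof
  fix x assume x: "x \<in> A"
  obtain W F where W: "x \<in> W" "smooth_open m W n F" "\<forall>y\<in>W \<inter> A. F y = f y"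
    using f x unfolding locally_extends_smoothly_def by blast
  obtain V G where V: "f x \<in> V" "smooth_open n V p G" "\<forall>y\<in>V \<inter> B. G y = g y"
    using g x AB unfolding locally_extends_smoothly_def by blast
  have oW: "openin (Euclidean_space m) W"
    using W(2) by (simp add: smooth_open_def)
  let ?W = "{y \<in> W. F y \<in> V}"
  have "openin (subtopology (Euclidean_space m) W) ?W"
    using openin_continuous_map_preimage[OF smooth_open_imp_continuous_map[OF W(2)], of V] V(2)
      openin_subset[OF oW]
    by (simp add: smooth_open_def inf.absorb2)
  then have "openin (Euclidean_space m) ?W"
    using oW openin_trans_full by blast
  then have smooth: "smooth_open m ?W p (G \<circ> F)"
    by (intro smooth_open_compose[OF smooth_open_subset[OF W(2)] V(2)]) auto
  have agree: "(G \<circ> F) y = (g \<circ> f) y" if "y \<in> ?W \<inter> A" for y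
  proof -
    have "F y = f y" "F y \<in> V" "f y \<in> B"
      using that W(3) AB by auto
    then show ?thesis
      using V(3) by simp
  qed
  show "\<exists>W F. x \<in> W \<and> smooth_open m W p F \<and> (\<forall>y\<in>W \<inter> A. F y = (g \<circ> f) y)"
  proof (rule exI, rule exI, intro conjI ballI)
    show "smooth_open m ?W p (G \<circ> F)"
      by (rule smooth)
    show "x \<in> ?W"
      using W(1,3) V(1) x by simp
    show "(G \<circ> F) y = (g \<circ> f) y" if "y \<in> ?W \<inter> A" for y
      using that by (rule agree)
  qed
qed

lemma locally_extends_smoothly_local:
  assumes "\<And>x. x \<in> A \<Longrightarrow> \<exists>U. openin (Euclidean_space m) U \<and> x \<in> U \<and>
    locally_extends_smoothly m (A \<inter> U) n g"
  shows "locally_extends_smoothly m A n g"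
  unfolding locally_extends_smoothly_def
proof
  fix x assume x: "x \<in> A"
  obtain U where U: "openin (Euclidean_space m) U" "x \<in> U" "locally_extends_smoothly m (A \<inter> U) n g"
    using assms[OF x] by blast
  obtain W F where W: "x \<in> W" "smooth_open m W n F" "\<forall>y\<in>W \<inter> (A \<inter> U). F y = g y"
    using x U(2,3) unfolding locally_extends_smoothly_def by blast
  have "openin (Euclidean_space m) (W \<inter> U)"
    using W(2) U(1) by (auto simp: smooth_open_def)
  then have "smooth_open m (W \<inter> U) n F"
    by (rule smooth_open_subset[OF W(2)]) auto
  then show "\<exists>W F. x \<in> W \<and> smooth_open m W n F \<and> (\<forall>y\<in>W \<inter> A. F y = g y)"
    using W U by blast
qed

section \<open>Composition of smooth maps between manifolds with corners\<close>

lemma is_chart_inj_on: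
  assumes "is_chart T c"
  shows "inj_on (chart_map c) (chart_dom c)"
proof -
  have "inj_on (chart_map c) (topspace (subtopology T (chart_dom c)))"
    using assms unfolding is_chart_def by (blast intro: homeomorphic_imp_injective_map)
  moreover have "chart_dom c \<subseteq> topspace T"
    using assms by (simp add: is_chart_def openin_subset)
  ultimately show ?thesis
    by (simp add: Int_absorb1)
qed

lemma is_chart_openin_image:
  assumes c: "is_chart T c" and U: "openin T U" "U \<subseteq> chart_dom c"
  shows "openin (sector (chart_corner c) (chart_dim c)) (chart_map c ` U)"
proof -
  have "openin (subtopology T (chart_dom c)) U"
    using U by (auto simp: openin_subtopology)
  then have "openin (subtopology (sector (chart_corner c) (chart_dim c)) (chart_img c)) (chart_map c ` U)"
    using c unfolding is_chart_def by (metis homeomorphic_map_openness_eq)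
  then show ?thesis
    using c openin_trans_full unfolding is_chart_def by blast
qed

text \<open>
  Near a point \<open>p\<close>, factor the coordinate expression of \<open>g \<circ> f\<close> through a chart \<open>d\<close> of \<open>N\<close> around
  \<open>f p\<close>.  The factorisation is valid on the points that \<open>f\<close> sends into the domain of \<open>d\<close>; their image
  under the chart \<open>c\<close> is open in a sector only, hence the trace of an open set \<open>V\<close> of Euclidean
  space, and smoothness may be tested on such sets.
\<close>

lemma smooth_map_compose:
  assumes M: "\<And>c. c \<in> atlas M \<Longrightarrow> is_chart (mtop M) c"
    and N: "\<And>d. d \<in> atlas N \<Longrightarrow> is_chart (mtop N) d" "carrier N \<subseteq> (\<Union>d\<in>atlas N. chart_dom d)"
    and f: "smooth_map M N f" and g: "smooth_map N P g"
  shows "smooth_map M P (g \<circ> f)"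
  unfolding smooth_map_def
proof (intro conjI ballI)
  show "continuous_map (mtop M) (mtop P) (g \<circ> f)"
    using f g unfolding smooth_map_def by (blast intro: continuous_map_compose)
  fix c e assume c: "c \<in> atlas M" and e: "e \<in> atlas P"
  let ?A = "chart_map c ` {p \<in> chart_dom c. (g \<circ> f) p \<in> chart_dom e}"
  have chart: "is_chart (mtop M) c" and inj: "inj_on (chart_map c) (chart_dom c)"
    using M[OF c] is_chart_inj_on by blast+
  show "locally_extends_smoothly (chart_dim c) ?A (chart_dim e) (chart_map e \<circ> (g \<circ> f) \<circ> chart_inv c)"
  proof (rule locally_extends_smoothly_local)
    fix x assume "x \<in> ?A"
    then obtain p where p: "p \<in> chart_dom c" "g (f p) \<in> chart_dom e" "x = chart_map c p"
      by auto
    have dom: "chart_dom c \<subseteq> carrier M"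
      using chart by (simp add: is_chart_def openin_subset)
    have fc: "continuous_map (mtop M) (mtop N) f"
      using f by (simp add: smooth_map_def)
    then have "f p \<in> carrier N"
      using dom p(1) by (auto simp: continuous_map_def)
    then obtain d where d: "d \<in> atlas N" "f p \<in> chart_dom d"
      using N(2) by blast
    have injd: "inj_on (chart_map d) (chart_dom d)"
      using N(1)[OF d(1)] by (rule is_chart_inj_on)
    let ?U = "{q \<in> chart_dom c. f q \<in> chart_dom d}"
    have "openin (mtop M) {q \<in> carrier M. f q \<in> chart_dom d}"
      using N(1)[OF d(1)] by (intro openin_continuous_map_preimage[OF fc]) (simp add: is_chart_def)
    then have "openin (mtop M) (chart_dom c \<inter> {q \<in> carrier M. f q \<in> chart_dom d})"
      using chart by (intro openin_Int) (auto simp: is_chart_def)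
    moreover have "chart_dom c \<inter> {q \<in> carrier M. f q \<in> chart_dom d} = ?U"
      using dom by auto
    ultimately have "openin (mtop M) ?U"
      by simp
    then have "openin (sector (chart_corner c) (chart_dim c)) (chart_map c ` ?U)"
      by (rule is_chart_openin_image[OF chart]) auto
    then obtain V where V: "openin (Euclidean_space (chart_dim c)) V"
        "chart_map c ` ?U = V \<inter> {x. \<forall>i<chart_corner c. 0 \<le> x i}"
      unfolding sector_def openin_subtopology by blast
    have "chart_img c \<subseteq> {x. \<forall>i<chart_corner c. 0 \<le> x i}"
    proof -
      have "chart_img c \<subseteq> topspace (sector (chart_corner c) (chart_dim c))"
        using chart by (intro openin_subset) (simp add: is_chart_def)
      then show ?thesis
        by (auto simp: sector_def)
    qed
    then have AV: "?A \<inter> V \<subseteq> chart_map c ` ?U"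
      using V(2) by auto
    have mid: "locally_extends_smoothly (chart_dim c) (?A \<inter> V) (chart_dim d)
        (chart_map d \<circ> f \<circ> chart_inv c)"
      using f c d(1) AV unfolding smooth_map_def by (blast intro: locally_extends_smoothly_subset)
    have "locally_extends_smoothly (chart_dim d)
        (chart_map d ` {q \<in> chart_dom d. g q \<in> chart_dom e}) (chart_dim e)
        (chart_map e \<circ> g \<circ> chart_inv d)"
      using g d(1) e unfolding smooth_map_def by blast
    moreover have inv: "chart_inv c y \<in> ?U \<and> g (f (chart_inv c y)) \<in> chart_dom e"
      if "y \<in> ?A \<inter> V" for y
      using that AV inj by (auto simp: inv_into_f_f)
    ultimately have "locally_extends_smoothly (chart_dim c) (?A \<inter> V) (chart_dim e)
        ((chart_map e \<circ> g \<circ> chart_inv d) \<circ> (chart_map d \<circ> f \<circ> chart_inv c))"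
      by (intro locally_extends_smoothly_compose[OF mid]) auto
    moreover have "((chart_map e \<circ> g \<circ> chart_inv d) \<circ> (chart_map d \<circ> f \<circ> chart_inv c)) y
        = (chart_map e \<circ> (g \<circ> f) \<circ> chart_inv c) y" if "y \<in> ?A \<inter> V" for y
      using inv[OF that] injd by (simp add: inv_into_f_f)
    ultimately have "locally_extends_smoothly (chart_dim c) (?A \<inter> V) (chart_dim e)
        (chart_map e \<circ> (g \<circ> f) \<circ> chart_inv c)"
      using locally_extends_smoothly_cong by blast
    moreover have "x \<in> V"
      using V(2) p d(2) by blast
    ultimately show "\<exists>U. openin (Euclidean_space (chart_dim c)) U \<and> x \<in> U \<and>
        locally_extends_smoothly (chart_dim c) (?A \<inter> U) (chart_dim e)
          (chart_map e \<circ> (g \<circ> f) \<circ> chart_inv c)"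
      using V(1) by blast
  qed
qed

text \<open>
  Smooth functions are normalised to be undefined off the carrier, so the pullback of one is a
  restricted composite; this lemma transfers smoothness to it.
\<close>

lemma smooth_map_cong:
  assumes charts: "\<And>c. c \<in> atlas M \<Longrightarrow> is_chart (mtop M) c"
    and fg: "\<And>p. p \<in> carrier M \<Longrightarrow> f p = g p" and f: "smooth_map M N f"
  shows "smooth_map M N g"
  unfolding smooth_map_def
proof (intro conjI ballI)
  show "continuous_map (mtop M) (mtop N) g"
    using f fg unfolding smooth_map_def by (blast intro: continuous_map_eq)
  fix c d assume c: "c \<in> atlas M" and d: "d \<in> atlas N"
  have chart: "is_chart (mtop M) c"
    using c by (rule charts)
  have eq: "f p = g p" if "p \<in> chart_dom c" for p
    using that chart openin_subset fg unfolding is_chart_def by blast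
  let ?A = "\<lambda>f. chart_map c ` {p \<in> chart_dom c. f p \<in> chart_dom d}"
  have "?A f = ?A g"
    using eq by auto
  moreover have "locally_extends_smoothly (chart_dim c) (?A f) (chart_dim d)
      (chart_map d \<circ> f \<circ> chart_inv c)"
    using f c d unfolding smooth_map_def by blast
  moreover have "(chart_map d \<circ> f \<circ> chart_inv c) y = (chart_map d \<circ> g \<circ> chart_inv c) y"
    if "y \<in> ?A g" for y
    using that eq by (auto simp: inv_into_into)
  ultimately show "locally_extends_smoothly (chart_dim c) (?A g) (chart_dim d)
      (chart_map d \<circ> g \<circ> chart_inv c)"
    by (simp only: locally_extends_smoothly_cong[of "?A g" "chart_map d \<circ> f \<circ> chart_inv c"])
qed

section \<open>Functoriality of the tangent map\<close>

lemma smooth_map_subset_carrier: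
  "smooth_map M N f \<Longrightarrow> p \<in> carrier M \<Longrightarrow> f p \<in> carrier N"
  unfolding smooth_map_def continuous_map_def by auto

text \<open>
  Tangent vectors are derivations, pushed forward by pulling functions back; so this is
  associativity of composition, once \<open>h \<circ> g\<close> is known to be a smooth function on \<open>N\<close> whenever \<open>h\<close>
  is one on \<open>P\<close>.  Without that, the derivation on \<open>N\<close> would take its default value at \<open>h \<circ> g\<close>.
\<close>

lemma tangent_map_compose:
  assumes N: "\<And>d. d \<in> atlas N \<Longrightarrow> is_chart (mtop N) d"
    and P: "\<And>e. e \<in> atlas P \<Longrightarrow> is_chart (mtop P) e" "carrier P \<subseteq> (\<Union>e\<in>atlas P. chart_dom e)"
    and f: "f ` carrier M \<subseteq> carrier N" and g: "smooth_map N P g"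
  shows "tangent_map M P (g \<circ> f) \<xi> = tangent_map N P g (tangent_map M N f \<xi>)"
proof -
  have "compose (carrier N) h g \<in> smooth_functions N" if "h \<in> smooth_functions P" for h
  proof -
    have "smooth_map N real_line (h \<circ> g)"
      using that by (intro smooth_map_compose[OF N P g]) (auto simp: smooth_functions_def)
    then have "smooth_map N real_line (compose (carrier N) h g)"
      by (rule smooth_map_cong[OF N, rotated 2]) (auto simp: compose_def)
    then show ?thesis
      by (simp add: smooth_functions_def)
  qed
  moreover have "compose (carrier M) (compose (carrier N) h g) f = compose (carrier M) h (g \<circ> f)"
    for h :: "_ \<Rightarrow> real"
    using f by (intro ext) (auto simp: compose_def restrict_def)
  ultimately show ?thesis
    by (auto simp: tangent_map_def intro!: restrict_ext split: prod.splits)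
qed

lemma related_compose:
  assumes N: "\<And>d. d \<in> atlas N \<Longrightarrow> is_chart (mtop N) d"
    and P: "\<And>e. e \<in> atlas P \<Longrightarrow> is_chart (mtop P) e" "carrier P \<subseteq> (\<Union>e\<in>atlas P. chart_dom e)"
    and f: "f ` carrier M \<subseteq> carrier N" and g: "smooth_map N P g"
    and XY: "related M N f X Y" and YZ: "related N P g Y Z"
  shows "related M P (g \<circ> f) X Z"
  unfolding related_def
proof
  fix p assume p: "p \<in> carrier M"
  have "tangent_map M P (g \<circ> f) (X p) = tangent_map N P g (tangent_map M N f (X p))"
    by (rule tangent_map_compose[OF N P f g])
  also have "\<dots> = tangent_map N P g (Y (f p))"
    using XY p by (simp add: related_def)
  also have "\<dots> = Z (g (f p))"
    using YZ f p unfolding related_def by blast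
  finally show "tangent_map M P (g \<circ> f) (X p) = Z ((g \<circ> f) p)"
    by simp
qed

section \<open>The functor from hybrid phase spaces to manifolds\<close>

definition summand_chart :: "'i \<Rightarrow> 'p chart \<Rightarrow> ('i \<times> 'p) chart" where
  "summand_chart x c = \<lparr>chart_dim = chart_dim c, chart_corner = chart_corner c,
     chart_dom = {x} \<times> chart_dom c, chart_map = chart_map c \<circ> snd\<rparr>"

lemma summand_chart_simps [simp]:
  "chart_dim (summand_chart x c) = chart_dim c"
  "chart_corner (summand_chart x c) = chart_corner c"
  "chart_dom (summand_chart x c) = {x} \<times> chart_dom c"
  "chart_map (summand_chart x c) = chart_map c \<circ> snd"
  by (simp_all add: summand_chart_def)

lemma atlas_U_ob:
  "atlas (U_ob a) = (\<Union>x\<in>Ob (base a). summand_chart x ` atlas (phase_mfd a x))"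
  by (simp add: U_ob_def summand_chart_def)

lemma mtop_U_ob: "mtop (U_ob a) = sum_topology (\<lambda>x. mtop (phase_mfd a x)) (Ob (base a))"
  by (simp add: U_ob_def)

lemma is_chart_summand_chart:
  assumes x: "x \<in> I" and c: "is_chart (T x) c"
  shows "is_chart (sum_topology T I) (summand_chart x c)"
proof -
  have D: "openin (T x) (chart_dom c)"
    using c by (simp add: is_chart_def)
  have open_summand: "openin (sum_topology T I) ({x} \<times> U)" if "openin (T x) U" for U
  proof -
    have "{p. (y, p) \<in> {x} \<times> U} = (if y = x then U else {})" for y
      by auto
    then show ?thesis
      using that x openin_subset[OF that] by (auto simp: openin_sum_topology)
  qed
  have "homeomorphic_maps (subtopology (sum_topology T I) ({x} \<times> chart_dom c))
      (subtopology (T x) (chart_dom c)) snd (Pair x)"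
    unfolding homeomorphic_maps_def
  proof (intro conjI)
    have "continuous_map (subtopology (sum_topology T I) ({x} \<times> chart_dom c)) (T x) snd"
      unfolding continuous_map_def
    proof (intro conjI allI impI)
      fix U assume U: "openin (T x) U"
      have "{p \<in> topspace (subtopology (sum_topology T I) ({x} \<times> chart_dom c)). snd p \<in> U}
          = ({x} \<times> U) \<inter> ({x} \<times> chart_dom c)"
        using x openin_subset[OF D] openin_subset[OF U] by auto
      then show "openin (subtopology (sum_topology T I) ({x} \<times> chart_dom c))
          {p \<in> topspace (subtopology (sum_topology T I) ({x} \<times> chart_dom c)). snd p \<in> U}"
        using open_summand[OF U] by (auto simp: openin_subtopology)
    qed auto
    then show "continuous_map (subtopology (sum_topology T I) ({x} \<times> chart_dom c))
        (subtopology (T x) (chart_dom c)) snd"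
      by (auto simp: continuous_map_in_subtopology)
    have "continuous_map (subtopology (T x) (chart_dom c)) (sum_topology T I) (Pair x)"
      using continuous_map_component_injection[OF x] by (rule continuous_map_from_subtopology)
    then show "continuous_map (subtopology (T x) (chart_dom c))
        (subtopology (sum_topology T I) ({x} \<times> chart_dom c)) (Pair x)"
      by (auto simp: continuous_map_in_subtopology)
  qed auto
  then have "homeomorphic_map (subtopology (sum_topology T I) ({x} \<times> chart_dom c))
      (subtopology (T x) (chart_dom c)) snd"
    using homeomorphic_map_maps by blast
  then have "homeomorphic_map (subtopology (sum_topology T I) ({x} \<times> chart_dom c))
      (subtopology (sector (chart_corner c) (chart_dim c)) (chart_img c)) (chart_map c \<circ> snd)"
    using c unfolding is_chart_def by (blast intro: homeomorphic_map_compose)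
  moreover have "(chart_map c \<circ> snd) ` ({x} \<times> chart_dom c) = chart_img c"
    by force
  ultimately show ?thesis
    using c open_summand[OF D] by (simp add: is_chart_def)
qed

lemma hybrid_phase_space_manifold:
  "hybrid_phase_space a \<Longrightarrow> x \<in> Ob (base a) \<Longrightarrow> manifold_with_corners (phase_mfd a x)"
  by (simp add: hybrid_phase_space_def is_functor_def RelMan_def)

lemma is_chart_U_ob:
  assumes "hybrid_phase_space a" "c \<in> atlas (U_ob a)"
  shows "is_chart (mtop (U_ob a)) c"
proof -
  obtain x d where "x \<in> Ob (base a)" "d \<in> atlas (phase_mfd a x)" "c = summand_chart x d"
    using assms(2) unfolding atlas_U_ob by blast
  with hybrid_phase_space_manifold[OF assms(1)] show ?thesis
    unfolding mtop_U_ob manifold_with_corners_def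
    by (blast intro: is_chart_summand_chart[where T = "\<lambda>x. mtop (phase_mfd a x)"])
qed

lemma U_ob_charts_cover:
  assumes "hybrid_phase_space a"
  shows "carrier (U_ob a) \<subseteq> (\<Union>c\<in>atlas (U_ob a). chart_dom c)"
proof
  fix q assume "q \<in> carrier (U_ob a)"
  then obtain x p where q: "q = (x, p)" "x \<in> Ob (base a)" "p \<in> carrier (phase_mfd a x)"
    by (auto simp: mtop_U_ob)
  then obtain c where "c \<in> atlas (phase_mfd a x)" "p \<in> chart_dom c"
    using hybrid_phase_space_manifold[OF assms q(2)] unfolding manifold_with_corners_def by blast
  with q show "q \<in> (\<Union>c\<in>atlas (U_ob a). chart_dom c)"
    by (auto simp: atlas_U_ob)
qed

lemma locally_extends_smoothly_empty: "locally_extends_smoothly m {} n g"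
  by (simp add: locally_extends_smoothly_def)

text \<open>
  Between summands \<open>x\<close> and \<open>\<phi> x\<close> the coordinate expressions are those of \<open>\<Phi> x\<close>, and between any other
  two summands their domain is empty.
\<close>

lemma smooth_map_U_map:
  assumes "is_hyph_map a b (\<phi>, \<Phi>)"
  shows "smooth_map (U_ob a) (U_ob b) (U_map (\<phi>, \<Phi>))"
  unfolding smooth_map_def
proof (intro conjI ballI)
  have a: "hybrid_phase_space a"
    and \<phi>: "\<And>x. x \<in> Ob (base a) \<Longrightarrow> on_ob \<phi> x \<in> Ob (base b)"
    and \<Phi>: "\<And>x. x \<in> Ob (base a) \<Longrightarrow> smooth_map (phase_mfd a x) (phase_mfd b (on_ob \<phi> x)) (\<Phi> x)"
    using assms by (auto simp: is_hyph_map_def is_functor_def)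
  show "continuous_map (mtop (U_ob a)) (mtop (U_ob b)) (U_map (\<phi>, \<Phi>))"
    unfolding continuous_map_def
  proof (intro conjI allI impI)
    show "U_map (\<phi>, \<Phi>) \<in> carrier (U_ob a) \<rightarrow> carrier (U_ob b)"
      using \<phi> smooth_map_subset_carrier[OF \<Phi>] by (auto simp: mtop_U_ob U_map_def)
    fix V assume V: "openin (mtop (U_ob b)) V"
    have "openin (mtop (phase_mfd a x)) {p. (x, p) \<in> {q \<in> carrier (U_ob a). U_map (\<phi>, \<Phi>) q \<in> V}}"
      if x: "x \<in> Ob (base a)" for x
    proof -
      have "openin (mtop (phase_mfd b (on_ob \<phi> x))) {r. (on_ob \<phi> x, r) \<in> V}"
        using V \<phi>[OF x] by (simp add: mtop_U_ob openin_sum_topology)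
      then have "openin (mtop (phase_mfd a x))
          {p \<in> carrier (phase_mfd a x). \<Phi> x p \<in> {r. (on_ob \<phi> x, r) \<in> V}}"
        using \<Phi>[OF x] unfolding smooth_map_def by (blast intro: openin_continuous_map_preimage)
      moreover have "{p. (x, p) \<in> {q \<in> carrier (U_ob a). U_map (\<phi>, \<Phi>) q \<in> V}}
          = {p \<in> carrier (phase_mfd a x). \<Phi> x p \<in> {r. (on_ob \<phi> x, r) \<in> V}}"
        using x by (auto simp: mtop_U_ob U_map_def)
      ultimately show ?thesis by simp
    qed
    then show "openin (mtop (U_ob a)) {q \<in> carrier (U_ob a). U_map (\<phi>, \<Phi>) q \<in> V}"
      unfolding mtop_U_ob openin_sum_topology by auto
  qed
  fix c d assume "c \<in> atlas (U_ob a)" "d \<in> atlas (U_ob b)"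
  then obtain x y c' d' where x: "x \<in> Ob (base a)" "c' \<in> atlas (phase_mfd a x)" "c = summand_chart x c'"
    and y: "y \<in> Ob (base b)" "d' \<in> atlas (phase_mfd b y)" "d = summand_chart y d'"
    unfolding atlas_U_ob by blast
  let ?A = "chart_map c ` {q \<in> chart_dom c. U_map (\<phi>, \<Phi>) q \<in> chart_dom d}"
  show "locally_extends_smoothly (chart_dim c) ?A (chart_dim d)
      (chart_map d \<circ> U_map (\<phi>, \<Phi>) \<circ> chart_inv c)"
  proof (cases "y = on_ob \<phi> x")
    case False
    then have "?A = {}"
      by (auto simp: x y U_map_def)
    then show ?thesis
      by (simp only: locally_extends_smoothly_empty)
  next
    case True
    have inj': "inj_on (chart_map c') (chart_dom c')"
      using hybrid_phase_space_manifold[OF a x(1)] x(2) is_chart_inj_on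
      unfolding manifold_with_corners_def by blast
    have inj: "inj_on (chart_map c) (chart_dom c)"
      using inj' by (auto simp: x inj_on_def)
    have A: "?A = chart_map c' ` {p \<in> chart_dom c'. \<Phi> x p \<in> chart_dom d'}"
      by (force simp: x y True U_map_def)
    have "(chart_map d \<circ> U_map (\<phi>, \<Phi>) \<circ> chart_inv c) z = (chart_map d' \<circ> \<Phi> x \<circ> chart_inv c') z"
      if "z \<in> ?A" for z
    proof -
      obtain p where p: "p \<in> chart_dom c'" "z = chart_map c' p"
        using \<open>z \<in> ?A\<close> unfolding A by blast
      have "chart_inv c z = (x, p)"
        using inv_into_f_f[OF inj, of "(x, p)"] p by (simp add: x)
      moreover have "chart_inv c' z = p"
        using inv_into_f_f[OF inj' p(1)] p(2) by simp
      ultimately show ?thesis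
        by (simp add: y U_map_def)
    qed
    moreover have "locally_extends_smoothly (chart_dim c') ?A (chart_dim d')
        (chart_map d' \<circ> \<Phi> x \<circ> chart_inv c')"
      unfolding A using \<Phi>[OF x(1)] x(2) y(2) unfolding smooth_map_def True by blast
    ultimately have "locally_extends_smoothly (chart_dim c') ?A (chart_dim d')
        (chart_map d \<circ> U_map (\<phi>, \<Phi>) \<circ> chart_inv c)"
      using locally_extends_smoothly_cong by blast
    then show ?thesis
      by (simp only: x(3) y(3) summand_chart_simps)
  qed
qed

lemma U_map_hyph_comp: "U_map (hyph_comp g f) = U_map g \<circ> U_map f"
  by (cases g; cases f) (auto simp: U_map_def hyph_comp_def functor_comp_def)

section \<open>Composition of maps of hybrid dynamical systems\<close>

lemma is_functor_functor_comp:
  assumes "is_functor C D F" "is_functor D E G"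
  shows "is_functor C E (functor_comp G F)"
  using assms unfolding is_functor_def functor_comp_def by simp

lemma is_hyph_map_hyph_comp:
  assumes f: "is_hyph_map a b f" and g: "is_hyph_map b c g"
  shows "is_hyph_map a c (hyph_comp g f)"
proof -
  obtain \<phi> \<Phi> \<psi> \<Psi> where fg: "f = (\<phi>, \<Phi>)" "g = (\<psi>, \<Psi>)"
    by (cases f; cases g)
  have spaces: "hybrid_phase_space a" "hybrid_phase_space b" "hybrid_phase_space c"
    and \<phi>: "is_functor (base a) (base b) \<phi>" and \<psi>: "is_functor (base b) (base c) \<psi>"
    using f g by (simp_all add: fg is_hyph_map_def)
  have ob: "on_ob \<phi> x \<in> Ob (base b)" if "x \<in> Ob (base a)" for x
    using \<phi> that by (simp add: is_functor_def)
  have "smooth_map (phase_mfd a x) (phase_mfd c (on_ob \<psi> (on_ob \<phi> x))) (\<Psi> (on_ob \<phi> x) \<circ> \<Phi> x)"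
    if x: "x \<in> Ob (base a)" for x
  proof (rule smooth_map_compose)
    show "smooth_map (phase_mfd a x) (phase_mfd b (on_ob \<phi> x)) (\<Phi> x)"
      using f x by (simp add: fg is_hyph_map_def)
    show "smooth_map (phase_mfd b (on_ob \<phi> x)) (phase_mfd c (on_ob \<psi> (on_ob \<phi> x))) (\<Psi> (on_ob \<phi> x))"
      using g ob[OF x] by (simp add: fg is_hyph_map_def)
  qed (use hybrid_phase_space_manifold[OF spaces(1) x]
      hybrid_phase_space_manifold[OF spaces(2) ob[OF x]] in \<open>auto simp: manifold_with_corners_def\<close>)
  moreover have "map_prod (\<Psi> (on_ob \<phi> (Dom (base a) \<gamma>)) \<circ> \<Phi> (Dom (base a) \<gamma>))
      (\<Psi> (on_ob \<phi> (Cod (base a) \<gamma>)) \<circ> \<Phi> (Cod (base a) \<gamma>)) ` phase_rel a \<gamma>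
      \<subseteq> phase_rel c (on_arr \<psi> (on_arr \<phi> \<gamma>))" if \<gamma>: "\<gamma> \<in> Arr (base a)" for \<gamma>
  proof -
    have \<gamma>': "on_arr \<phi> \<gamma> \<in> Arr (base b)"
      "Dom (base b) (on_arr \<phi> \<gamma>) = on_ob \<phi> (Dom (base a) \<gamma>)"
      "Cod (base b) (on_arr \<phi> \<gamma>) = on_ob \<phi> (Cod (base a) \<gamma>)"
      using \<phi> \<gamma> by (simp_all add: is_functor_def)
    have "map_prod (\<Phi> (Dom (base a) \<gamma>)) (\<Phi> (Cod (base a) \<gamma>)) ` phase_rel a \<gamma>
        \<subseteq> phase_rel b (on_arr \<phi> \<gamma>)"
      using f \<gamma> by (simp add: fg is_hyph_map_def)
    moreover have "map_prod (\<Psi> (on_ob \<phi> (Dom (base a) \<gamma>))) (\<Psi> (on_ob \<phi> (Cod (base a) \<gamma>)))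
        ` phase_rel b (on_arr \<phi> \<gamma>) \<subseteq> phase_rel c (on_arr \<psi> (on_arr \<phi> \<gamma>))"
      using g \<gamma>' by (fastforce simp: fg is_hyph_map_def)
    ultimately show ?thesis
      unfolding map_prod_compose image_comp[symmetric] by blast
  qed
  ultimately show ?thesis
    using spaces is_functor_functor_comp[OF \<phi> \<psi>]
    by (simp add: fg is_hyph_map_def hyph_comp_def functor_comp_def)
qed

text \<open>
  Related vector fields compose because \<^const>\<open>U_map\<close> respects composition and takes values in smooth
  maps, to which functoriality of the tangent map applies.
\<close>

lemma is_hds_map_hyph_comp:
  assumes f: "is_hds_map A B f" and g: "is_hds_map B C g"
  shows "is_hds_map A C (hyph_comp g f)"
proof -
  obtain a X b Y c Z where ABC: "A = (a, X)" "B = (b, Y)" "C = (c, Z)"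
    by (metis surj_pair)
  have hyph: "is_hyph_map a b f" "is_hyph_map b c g"
    and rel: "related (U_ob a) (U_ob b) (U_map f) X Y" "related (U_ob b) (U_ob c) (U_map g) Y Z"
    using f g by (simp_all add: ABC is_hds_map_def)
  have spaces: "hybrid_phase_space a" "hybrid_phase_space b" "hybrid_phase_space c"
    using hyph by (auto simp: is_hyph_map_def)
  have smooth: "smooth_map (U_ob a) (U_ob b) (U_map f)" "smooth_map (U_ob b) (U_ob c) (U_map g)"
    using hyph smooth_map_U_map by (metis surj_pair)+
  have "related (U_ob a) (U_ob c) (U_map g \<circ> U_map f) X Z"
    using spaces[THEN is_chart_U_ob] U_ob_charts_cover[OF spaces(3)]
      smooth_map_subset_carrier[OF smooth(1)] smooth(2) rel
    by (intro related_compose[of "U_ob b" "U_ob c"]) blast+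
  then show ?thesis
    using f g is_hyph_map_hyph_comp[OF hyph]
    by (simp add: ABC is_hds_map_def U_map_hyph_comp)
qed

theorem theorem4p23:
  fixes a :: "('o, 'm, 'p) hyph" and b :: "('u, 'n, 'q) hyph"
    and X :: "'o \<times> 'p \<Rightarrow> ('o \<times> 'p) \<times> (('o \<times> 'p \<Rightarrow> real) \<Rightarrow> real)"
    and Y :: "'u \<times> 'q \<Rightarrow> ('u \<times> 'q) \<times> (('u \<times> 'q \<Rightarrow> real) \<Rightarrow> real)"
    and \<psi> :: "('o, 'm, 'u, 'n) cfunctor" and \<Psi> :: "'o \<Rightarrow> 'p \<Rightarrow> 'q"
    and t :: "nat \<Rightarrow> real"
    and \<phi> :: "(nat, nat \<times> nat list, 'o, 'm) cfunctor" and \<sigma> :: "nat \<Rightarrow> real \<Rightarrow> 'p"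
  assumes "is_hds_map (a, X) (b, Y) (\<psi>, \<Psi>)"
    and "is_execution (a, X) t (\<phi>, \<sigma>)"
  shows "is_execution (b, Y) t (hyph_comp (\<psi>, \<Psi>) (\<phi>, \<sigma>))"
  using assms is_hds_map_hyph_comp unfolding is_execution_def by blast

end
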